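(* Let $p\ge 1$ be an integer and let $\boldsymbol{\beta}=(\beta_0,\ldots,\beta_{p-1})$ be a $p$-tuple of real numbers greater than $1$. If the map $f_{\boldsymbol{\beta}}$ is non-decreasing (with respect to the lexicographic order), then $T_{\beta_{p-1}\cdots\beta_0,\Delta_{\boldsymbol{\beta}}}=\pi_2\circ T_{\boldsymbol{\beta}}^p\circ{\delta_0}_{|[0,x_{\boldsymbol{\beta}})}$ as maps on $[0,x_{\boldsymbol{\beta}})$.
   Context: Conventions: for $n\in\mathbb{Z}$, $\beta_n=\beta_{n\bmod p}$ and $\boldsymbol{\beta}^{(n)}=(\beta_n,\ldots,\beta_{n+p-1})$; empty products equal $1$. $x_{\boldsymbol{\beta}}=\sum_{n=0}^\infty\frac{\lceil\beta_n\rceil-1}{\prod_{k=0}^n\beta_k}$ (finite and $\ge1$), and $x_{\boldsymbol{\beta}^{(n)}}$ is the same quantity for $\boldsymbol{\beta}^{(n)}$. Extended greedy $\boldsymbol{\beta}$-transformation on $\bigcup_{i=0}^{p-1}(\{i\}\times[0,x_{\boldsymbol{\beta}^{(i)}}))$: $T_{\boldsymbol{\beta}}(i,x)=((i+1)\bmod p,\ \beta_ix-\lfloor\beta_ix\rfloor)$ if $x\in[0,1)$, and $T_{\boldsymbol{\beta}}(i,x)=((i+1)\bmod p,\ \beta_ix-(\lceil\beta_i\rceil-1))$ if $x\in[1,x_{\boldsymbol{\beta}^{(i)}})$. $\delta_0(x)=(0,x)$ and $\pi_2(n,x)=x$. Define $f_{\boldsymbol{\beta}}\colon\prod_{i=0}^{p-1}\{0,\ldots,\lceil\beta_i\rceil-1\}\to\mathbb{R}$,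 $f_{\boldsymbol{\beta}}(c_0,\ldots,c_{p-1})=\sum_{i=0}^{p-1}\beta_{p-1}\cdots\beta_{i+1}c_i$, and $\Delta_{\boldsymbol{\beta}}=\mathrm{im}(f_{\boldsymbol{\beta}})$. The domain is ordered lexicographically: $c<_{\mathrm{lex}}c'$ if there is $i$ with $c_0=c_0',\ldots,c_{i-1}=c'_{i-1}$ and $c_i<c_i'$; $f_{\boldsymbol{\beta}}$ is non-decreasing if $c<_{\mathrm{lex}}c'$ implies $f_{\boldsymbol{\beta}}(c)\le f_{\boldsymbol{\beta}}(c')$. For a real $\beta>1$ and a finite set $\Delta=\{d_0,\ldots,d_m\}$ with $0=d_0<d_1<\cdots<d_m$ and $\max_{0\le k\le m-1}(d_{k+1}-d_k)\le\frac{d_m}{\beta-1}$ (an allowable digit set for $\beta$), the greedy $(\beta,\Delta)$-transformation $T_{\beta,\Delta}\colon[0,\frac{d_m}{\beta-1})\to[0,\frac{d_m}{\beta-1})$ is $T_{\beta,\Delta}(x)=\beta x-d_k$ if $x\in[\frac{d_k}{\beta},\frac{d_{k+1}}{\beta})$ with $0\le k\le m-1$, and $T_{\beta,\Delta}(x)=\beta x-d_m$ if $x\in[\frac{d_m}{\beta},\frac{d_m}{\beta-1})$. The set $\Delta_{\boldsymbol{\beta}}$ is an allowable digit set for $\beta_{p-1}\cdots\beta_0$, and $x_{\boldsymbol{\beta}}=\frac{\max\Delta_{\boldsymbol{\beta}}}{\beta_{p-1}\cdots\beta_0-1}$. *)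

theory Defs
  imports "HOL-Analysis.Analysis"
begin

text \<open>
  A tuple of bases \<open>(\<beta>\<^sub>0, \<dots>, \<beta>\<^sub>p\<^sub>-\<^sub>1)\<close> is a \<open>real list\<close> of length \<open>p\<close>.
  Only indices \<open>n \<ge> 0\<close> of the \<open>p\<close>-periodic extension are ever used.
\<close>

definition base_at :: "real list \<Rightarrow> nat \<Rightarrow> real" where
  "base_at \<beta> n = \<beta> ! (n mod length \<beta>)"

definition shifted :: "real list \<Rightarrow> nat \<Rightarrow> real list" where
  "shifted \<beta> n = map (base_at \<beta>) [n..<n + length \<beta>]"

definition x_base :: "real list \<Rightarrow> real" where
  "x_base \<beta> = (\<Sum>n. (real_of_int \<lceil>base_at \<beta> n\<rceil> - 1) / (\<Prod>k=0..n. base_at \<beta> k))"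

definition greedy_dom :: "real list \<Rightarrow> (nat \<times> real) set" where
  "greedy_dom \<beta> = (SIGMA i:{..<length \<beta>}. {0..<x_base (shifted \<beta> i)})"

text \<open>
  Maps with a prescribed domain are extensional functions: \<^const>\<open>restrict\<close> makes them
  \<^const>\<open>undefined\<close> off the domain.
\<close>

definition greedy :: "real list \<Rightarrow> nat \<times> real \<Rightarrow> nat \<times> real" where
  "greedy \<beta> = restrict (\<lambda>(i, x).
     ((i + 1) mod length \<beta>,
      if x < 1 then \<beta> ! i * x - real_of_int \<lfloor>\<beta> ! i * x\<rfloor>
      else \<beta> ! i * x - (real_of_int \<lceil>\<beta> ! i\<rceil> - 1))) (greedy_dom \<beta>)"

definition delta0 :: "real \<Rightarrow> nat \<times> real" where
  "delta0 x = (0, x)"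

definition digit_tuples :: "real list \<Rightarrow> int list set" where
  "digit_tuples \<beta> = {c. length c = length \<beta> \<and> (\<forall>i<length \<beta>. c ! i \<in> {0..\<lceil>\<beta> ! i\<rceil> - 1})}"

definition f_base :: "real list \<Rightarrow> int list \<Rightarrow> real" where
  "f_base \<beta> c = (\<Sum>i<length \<beta>. (\<Prod>j\<in>{i<..<length \<beta>}. \<beta> ! j) * real_of_int (c ! i))"

definition Delta :: "real list \<Rightarrow> real set" where
  "Delta \<beta> = f_base \<beta> ` digit_tuples \<beta>"

text \<open>\<^const>\<open>lex\<close> only relates lists of equal length.\<close>

definition lex_less :: "int list \<Rightarrow> int list \<Rightarrow> bool" where
  "lex_less c c' \<longleftrightarrow> (c, c') \<in> lex {(a, b). a < b}"

definition f_nondecreasing :: "real list \<Rightarrow> bool" where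
  "f_nondecreasing \<beta> \<longleftrightarrow> monotone_on (digit_tuples \<beta>) lex_less (\<le>) (f_base \<beta>)"

text \<open>
  The digits of the finite set \<open>D\<close> in increasing order are \<open>digit D 0 < \<dots> < digit D (card D - 1)\<close>.
\<close>

definition digit :: "real set \<Rightarrow> nat \<Rightarrow> real" where
  "digit D k = sorted_list_of_set D ! k"

text \<open>
  The definition is meaningful when \<open>b > 1\<close> and \<open>D\<close> is an allowable digit set for \<open>b\<close>: then
  \<open>digit D 0 = 0\<close>, so for every \<open>x\<close> of the domain below the last cut point exactly one index
  \<open>k\<close> satisfies the condition under \<open>THE\<close>.
\<close>

definition greedy_digits :: "real \<Rightarrow> real set \<Rightarrow> real \<Rightarrow> real" where
  "greedy_digits b D = (let m = card D - 1 in
     restrict (\<lambda>x.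
       if x \<in> {digit D m / b..<digit D m / (b - 1)} then b * x - digit D m
       else b * x - digit D (THE k. k < m \<and> x \<in> {digit D k / b..<digit D (k + 1) / b}))
     {0..<digit D m / (b - 1)})"

end

theory Submission
  imports Defs
begin

text \<open>
  Along the \<open>\<beta>\<close>-orbit of \<open>x\<close>, let \<open>c\<close> be the tuple of the first \<open>p\<close> digits. The \<open>p\<close>-th remainder
  is \<open>\<beta>\<^sub>p\<^sub>-\<^sub>1 \<cdots> \<beta>\<^sub>0 x - f(c)\<close>. If a tuple \<open>c'\<close> first differs from \<open>c\<close> at \<open>i\<close> with \<open>c' ! i > c ! i\<close>, then
  the \<open>i\<close>-th digit is not maximal, so the remainder after it is below \<open>1\<close>, and hence
  \<open>f(c') > \<beta>\<^sub>p\<^sub>-\<^sub>1 \<cdots> \<beta>\<^sub>0 x\<close>. Thus \<open>c\<close> is lexicographically maximal among the tuples with value at most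
  \<open>\<beta>\<^sub>p\<^sub>-\<^sub>1 \<cdots> \<beta>\<^sub>0 x\<close>, and monotonicity of \<open>f\<close> makes \<open>f(c)\<close> the digit chosen by the greedy
  transformation with digit set \<open>Delta \<beta>\<close>.
\<close>

section \<open>The greedy transformation with an arbitrary digit set\<close>

lemma digit_in:
  assumes "finite D" "k < card D"
  shows "digit D k \<in> D"
  using assms nth_mem[of k "sorted_list_of_set D"] by (simp add: digit_def)

lemma digit_less_iff:
  assumes "finite D" "j < card D" "k < card D"
  shows "digit D j < digit D k \<longleftrightarrow> j < k"
proof -
  have mono: "digit D a < digit D b" if "a < b" "b < card D" for a b
    using sorted_wrt_nth_less[OF strict_sorted_list_of_set[of D], of a b] that
    by (simp add: digit_def)
  show ?thesis
    using mono[of j k] mono[of k j] assms by (metis less_asym' linorder_neqE_nat order_less_irrefl)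
qed

lemma ex_digit_eq:
  assumes "finite D" "d \<in> D"
  obtains k where "k < card D" "digit D k = d"
  using assms by (metis digit_def in_set_conv_nth length_sorted_list_of_set set_sorted_list_of_set)

lemma digit_last_eq_Max:
  assumes "finite D" "D \<noteq> {}"
  shows "digit D (card D - 1) = Max D"
proof (rule sym, rule Max_eqI)
  have pos: "0 < card D" using assms by (simp add: card_gt_0_iff)
  then show "digit D (card D - 1) \<in> D" using assms by (intro digit_in) auto
  fix y assume "y \<in> D"
  then obtain k where k: "k < card D" "digit D k = y" using assms ex_digit_eq by metis
  have "\<not> digit D (card D - 1) < digit D k" using k pos assms by (subst digit_less_iff) auto
  then show "y \<le> digit D (card D - 1)" using k by simp
qed (use assms in simp)

text \<open>Multiplying the cut points by \<open>b\<close> turns the choice of a branch into a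
  comparison of \<open>b * x\<close> with the digits, so every branch subtracts the largest digit
  not exceeding \<open>b * x\<close>. In this form the digits need no enumeration.\<close>

lemma greedy_digits_eqI:
  assumes D: "finite D" and b: "b > 0" and x: "0 \<le> x" "x < Max D / (b - 1)"
    and d: "d \<in> D" "d \<le> b * x" and max: "\<And>d'. d' \<in> D \<Longrightarrow> d' \<le> b * x \<Longrightarrow> d' \<le> d"
  shows "greedy_digits b D x = b * x - d"
proof -
  define m where "m = card D - 1"
  have ne: "D \<noteq> {}" using d by auto
  have card: "card D = Suc m" using D ne by (simp add: m_def card_gt_0_iff)
  have dm: "digit D m = Max D" unfolding m_def using D ne by (rule digit_last_eq_Max)
  have unf: "greedy_digits b D x = (if Max D / b \<le> x then b * x - Max D else
      b * x - digit D (THE k. k < m \<and> x \<in> {digit D k / b..<digit D (k + 1) / b}))"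
    unfolding greedy_digits_def Let_def m_def[symmetric] dm using x by auto
  show ?thesis
  proof (cases "Max D / b \<le> x")
    case True
    then have "Max D \<le> b * x" using b by (simp add: field_simps)
    then have "Max D \<le> d" using max D ne by simp
    then have "d = Max D" using D d by (simp add: antisym)
    then show ?thesis using unf True by simp
  next
    case False
    then have lt: "b * x < Max D" using b by (simp add: field_simps)
    obtain k where k: "k < card D" "digit D k = d" using D d ex_digit_eq by metis
    have "k \<noteq> m" using k dm lt d by auto
    then have km: "k < m" using k card by simp
    \<comment> \<open>A next digit at most \<open>b * x\<close> would, by maximality of
      \<open>d\<close>, be at most \<open>digit D k\<close>, against the strict enumeration.\<close>
    have above: "b * x < digit D (Suc k)"
    proof (rule ccontr)
      assume "\<not> ?thesis"
      then have "digit D (Suc k) \<le> digit D k"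
        using max[of "digit D (Suc k)"] digit_in[OF D] km card k by auto
      then show False using digit_less_iff[OF D, of k "Suc k"] km card by simp
    qed
    have "(THE k. k < m \<and> x \<in> {digit D k / b..<digit D (k + 1) / b}) = k"
    proof (rule the_equality)
      show "k < m \<and> x \<in> {digit D k / b..<digit D (k + 1) / b}"
        using km above d k b by (simp add: field_simps)
    next
      fix j assume "j < m \<and> x \<in> {digit D j / b..<digit D (j + 1) / b}"
      then have j: "j < m" "digit D j \<le> b * x" "b * x < digit D (Suc j)"
        using b by (auto simp: field_simps)
      \<comment> \<open>Two half-open intervals containing \<open>x\<close>: comparing each left end
        with the other's right end gives \<open>j \<le> k\<close> and
        \<open>k \<le> j\<close>.\<close>
      have "digit D j < digit D (Suc k)" "digit D k < digit D (Suc j)"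
        using j above d k by linarith+
      then show "j = k"
        using digit_less_iff[OF D, of j "Suc k"] digit_less_iff[OF D, of k "Suc j"] j km card
        by simp
    qed
    then show ?thesis using unf False k by simp
  qed
qed

lemma lex_lessI:
  assumes "length c = length c'" "i < length c" "\<And>j. j < i \<Longrightarrow> c ! j = c' ! j" "c ! i < c' ! i"
  shows "lex_less c c'"
proof -
  have "take i c = take i c'" using assms by (intro nth_take_lemma) auto
  then have "c = take i c @ c ! i # drop (Suc i) c" "c' = take i c @ c' ! i # drop (Suc i) c'"
    using assms id_take_nth_drop[of i c] id_take_nth_drop[of i c'] by auto
  then show ?thesis unfolding lex_less_def lex_conv using assms by blast
qed

section \<open>The quantities \<open>x_base\<close>\<close>

lemma base_at_shifted: "\<beta> \<noteq> [] \<Longrightarrow> base_at (shifted \<beta> n) k = base_at \<beta> (n + k)"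
  by (simp add: base_at_def shifted_def mod_add_right_eq)

locale bases =
  fixes \<beta> :: "real list"
  assumes nonempty: "\<beta> \<noteq> []"
    and gt_1: "i < length \<beta> \<Longrightarrow> \<beta> ! i > 1"
begin

abbreviation p :: nat where "p \<equiv> length \<beta>"

lemma base_at_gt_1: "base_at \<beta> n > 1"
  using gt_1 nonempty by (simp add: base_at_def)

lemma base_at_pos: "base_at \<beta> n > 0"
  using base_at_gt_1[of n] by linarith

lemma base_at_less: "i < p \<Longrightarrow> base_at \<beta> i = \<beta> ! i"
  by (simp add: base_at_def)

text \<open>For \<open>n < p\<close> this is the right end of the fibre of \<open>greedy_dom\<close>
  over \<open>n\<close>. Letting \<open>n\<close> be arbitrary allows the recursion
  \<open>bound_Suc\<close> to run through a whole period, up to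
  \<open>bound p = bound 0\<close>.\<close>

definition bound :: "nat \<Rightarrow> real" where
  "bound n = x_base (shifted \<beta> n)"

definition bound_term :: "nat \<Rightarrow> nat \<Rightarrow> real" where
  "bound_term n k = (real_of_int \<lceil>base_at \<beta> (n + k)\<rceil> - 1) / (\<Prod>j=0..k. base_at \<beta> (n + j))"

lemma bound_eq_suminf: "bound n = (\<Sum>k. bound_term n k)"
  by (simp add: bound_def x_base_def bound_term_def base_at_shifted nonempty)

lemma bound_0: "bound 0 = x_base \<beta>"
  by (simp add: bound_eq_suminf bound_term_def x_base_def)

lemma bound_length: "bound p = x_base \<beta>"
  unfolding bound_0[symmetric] bound_eq_suminf bound_term_def by (simp add: base_at_def)

text \<open>The inverse products decay at least geometrically, so they are summable and tend to 0,
  and the telescoping sum keeps only the empty product 1. The two series bound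
  \<open>bound_term\<close> from below and above.\<close>

lemma inverse_prod_sums:
  "(\<lambda>k. inverse (\<Prod>j<k. base_at \<beta> (n + j)) - inverse (\<Prod>j<Suc k. base_at \<beta> (n + j))) sums 1"
  and summable_inverse_prod: "summable (\<lambda>k. inverse (\<Prod>j<k. base_at \<beta> (n + j)))"
proof -
  \<comment> \<open>The smallest of the finitely many bases still exceeds 1 and bounds all of the
    periodic sequence from below.\<close>
  define q where "q = Min (set \<beta>)"
  have q: "q > 1"
    using nonempty gt_1 by (auto simp: q_def in_set_conv_nth)
  have q_le: "q \<le> base_at \<beta> i" for i
    using nonempty by (simp add: q_def base_at_def)
  have "q ^ k \<le> (\<Prod>j<k. base_at \<beta> (n + j))" for k
    using prod_mono[of "{..<k}" "\<lambda>_. q" "\<lambda>j. base_at \<beta> (n + j)"] q q_le by simp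
  then have le: "inverse (\<Prod>j<k. base_at \<beta> (n + j)) \<le> inverse q ^ k" for k
    using q by (simp add: le_imp_inverse_le power_inverse)
  show sm: "summable (\<lambda>k. inverse (\<Prod>j<k. base_at \<beta> (n + j)))"
  proof (rule summable_comparison_test')
    show "summable (\<lambda>k. inverse q ^ k)" using q by (simp add: inverse_less_1_iff)
    show "norm (inverse (\<Prod>j<k. base_at \<beta> (n + j))) \<le> inverse q ^ k" if "0 \<le> k" for k
      using le[of k] base_at_pos by (simp add: prod_nonneg less_imp_le abs_of_nonneg)
  qed
  show "(\<lambda>k. inverse (\<Prod>j<k. base_at \<beta> (n + j)) - inverse (\<Prod>j<Suc k. base_at \<beta> (n + j))) sums 1"
    using telescope_sums'[OF summable_LIMSEQ_zero[OF sm]] by simp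
qed

lemma bound_term_nonneg: "0 \<le> bound_term n k"
  unfolding bound_term_def using base_at_gt_1 base_at_pos
  by (intro divide_nonneg_nonneg prod_nonneg) (auto simp: less_imp_le)

lemma prod_base_at_pos: "0 < (\<Prod>j<k. base_at \<beta> (n + j))"
  using base_at_pos by (simp add: prod_pos)

lemma bound_term_ge:
  "inverse (\<Prod>j<k. base_at \<beta> (n + j)) - inverse (\<Prod>j<Suc k. base_at \<beta> (n + j)) \<le> bound_term n k"
proof -
  have "inverse P - inverse (P * b) = (b - 1) / (P * b)" if "0 < P" "0 < b" for P b :: real
    using that by (simp add: field_simps)
  from this[OF prod_base_at_pos[of n k] base_at_pos[of "n + k"]]
  have "inverse (\<Prod>j<k. base_at \<beta> (n + j)) - inverse (\<Prod>j<Suc k. base_at \<beta> (n + j))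
      = (base_at \<beta> (n + k) - 1) / (\<Prod>j<Suc k. base_at \<beta> (n + j))"
    by simp
  also have "\<dots> \<le> bound_term n k"
    unfolding bound_term_def atLeast0AtMost lessThan_Suc_atMost[symmetric]
    using prod_base_at_pos[of n "Suc k"] by (intro divide_right_mono) (auto simp: less_imp_le)
  finally show ?thesis .
qed

lemma bound_term_le: "bound_term n k \<le> inverse (\<Prod>j<k. base_at \<beta> (n + j))"
proof -
  have "bound_term n k \<le> base_at \<beta> (n + k) / (\<Prod>j<Suc k. base_at \<beta> (n + j))"
    unfolding bound_term_def atLeast0AtMost lessThan_Suc_atMost[symmetric]
    using prod_base_at_pos[of n "Suc k"]
    by (intro divide_right_mono) (use ceiling_correct[of "base_at \<beta> (n + k)"] in auto)
  also have "\<dots> = inverse (\<Prod>j<k. base_at \<beta> (n + j))"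
    using prod_base_at_pos[of n k] base_at_pos[of "n + k"] by (simp add: field_simps)
  finally show ?thesis .
qed

lemma summable_bound_term: "summable (bound_term n)"
  using summable_comparison_test'[OF summable_inverse_prod[of n], of 0 "bound_term n"]
    bound_term_le bound_term_nonneg by (simp add: abs_of_nonneg)

lemma bound_ge_1: "1 \<le> bound n"
  unfolding bound_eq_suminf
  using sums_le[OF bound_term_ge inverse_prod_sums summable_sums[OF summable_bound_term]] by simp

text \<open>All terms after the first share the factor \<open>1 / base_at \<beta> n\<close>.
  Dynamically, the branch with the maximal digit carries the right end of one fibre to that of the
  next.\<close>

lemma bound_Suc: "base_at \<beta> n * bound n = real_of_int \<lceil>base_at \<beta> n\<rceil> - 1 + bound (Suc n)"
proof -
  have tail: "bound_term n (Suc k) = bound_term (Suc n) k / base_at \<beta> n" for k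
  proof -
    have "(\<Prod>j=0..Suc k. base_at \<beta> (n + j)) = base_at \<beta> n * (\<Prod>j=0..k. base_at \<beta> (Suc n + j))"
      unfolding atLeast0AtMost by (subst prod.atMost_Suc_shift) simp
    then show ?thesis by (simp add: bound_term_def)
  qed
  have "bound n = bound_term n 0 + (\<Sum>k. bound_term n (Suc k))"
    unfolding bound_eq_suminf using suminf_split_head[OF summable_bound_term[of n]] by simp
  also have "\<dots> = bound_term n 0 + bound (Suc n) / base_at \<beta> n"
    unfolding tail bound_eq_suminf by (simp add: suminf_divide summable_bound_term)
  finally show ?thesis using base_at_pos[of n] by (simp add: bound_term_def field_simps)
qed

section \<open>Digit tuples\<close>

text \<open>The coefficient of \<open>c ! i\<close> in \<open>f_base\<close> is
  \<open>weight (Suc i)\<close>. The shift makes \<open>weight 0\<close> the full product and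
  \<open>weight p\<close> the empty one.\<close>

definition weight :: "nat \<Rightarrow> real" where
  "weight i = (\<Prod>j\<in>{i..<p}. \<beta> ! j)"

lemma weight_pos: "0 < weight i"
  unfolding weight_def using gt_1 by (intro prod_pos) fastforce

lemma weight_eq: "i < p \<Longrightarrow> weight i = \<beta> ! i * weight (Suc i)"
  by (simp add: weight_def prod.atLeast_Suc_lessThan)

lemma weight_0: "weight 0 = prod_list \<beta>"
  by (simp add: weight_def prod.list_conv_set_nth atLeast0LessThan)

lemma weight_length: "weight p = 1"
  by (simp add: weight_def)

lemma prod_list_gt_1: "1 < prod_list \<beta>"
proof -
  have "1 < weight 0"
    unfolding weight_def using nonempty gt_1 by (intro less_1_prod) auto
  then show ?thesis by (simp add: weight_0)
qed

lemma f_base_eq: "f_base \<beta> c = (\<Sum>i<p. weight (Suc i) * real_of_int (c ! i))"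
  by (simp add: f_base_def weight_def atLeastSucLessThan_greaterThanLessThan)

text \<open>The recursion is unrolled for an arbitrary real sequence \<open>r\<close>, because it
  serves twice: for the right ends \<open>bound\<close> with maximal digits, and for the orbit
  \<open>remainder\<close> with greedy digits.\<close>

lemma expansion:
  assumes "\<And>i. i < n \<Longrightarrow> r (Suc i) = \<beta> ! i * r i - c i" "n \<le> p"
  shows "prod_list \<beta> * r 0 = (\<Sum>i<n. weight (Suc i) * c i) + weight n * r n"
  using assms
proof (induction n)
  case 0
  then show ?case by (simp add: weight_0)
next
  case (Suc n)
  have "weight n * r n = weight (Suc n) * (\<beta> ! n * r n)"
    using Suc.prems by (simp add: weight_eq)
  also have "\<dots> = weight (Suc n) * c n + weight (Suc n) * r (Suc n)"
    using Suc.prems(1)[of n] by (simp flip: distrib_left)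
  finally have "weight n * r n = weight (Suc n) * c n + weight (Suc n) * r (Suc n)" .
  with Suc show ?case by simp
qed

lemma finite_digit_tuples: "finite (digit_tuples \<beta>)"
proof (rule finite_subset)
  define N where "N = Max ((\<lambda>b. \<lceil>b\<rceil>) ` set \<beta>)"
  have "\<lceil>\<beta> ! i\<rceil> \<le> N" if "i < p" for i
    unfolding N_def using that by (intro Max_ge) auto
  then show "digit_tuples \<beta> \<subseteq> {c. set c \<subseteq> {0..N} \<and> length c = p}"
    by (fastforce simp: digit_tuples_def in_set_conv_nth)
  show "finite {c. set c \<subseteq> {0..N} \<and> length c = p}"
    by (intro finite_lists_length_eq) simp
qed

lemma finite_Delta: "finite (Delta \<beta>)"
  by (simp add: Delta_def finite_digit_tuples)

lemma f_base_mono: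
  assumes "\<And>i. i < p \<Longrightarrow> c ! i \<le> c' ! i"
  shows "f_base \<beta> c \<le> f_base \<beta> c'"
  unfolding f_base_eq
  using assms weight_pos by (intro sum_mono mult_left_mono) (auto simp: less_imp_le)

text \<open>The coefficients of \<open>f_base\<close> are positive, so the tuple of maximal digits
  attains the maximum. Unrolling \<open>bound\<close> over one period returns to
  \<open>x_base \<beta>\<close> and leaves a linear equation for it.\<close>

lemma Max_Delta: "Max (Delta \<beta>) / (prod_list \<beta> - 1) = x_base \<beta>"
proof -
  define top where "top = map (\<lambda>b. \<lceil>b\<rceil> - 1) \<beta>"
  have nth: "top ! i = \<lceil>\<beta> ! i\<rceil> - 1" if "i < p" for i
    using that by (simp add: top_def)
  have ceil: "1 \<le> \<lceil>\<beta> ! i\<rceil>" if "i < p" for i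
    using gt_1[OF that] by linarith
  have "Max (Delta \<beta>) = f_base \<beta> top"
  proof (rule Max_eqI[OF finite_Delta])
    show "f_base \<beta> top \<in> Delta \<beta>"
      unfolding Delta_def using ceil by (intro imageI) (auto simp: digit_tuples_def top_def)
    show "d \<le> f_base \<beta> top" if "d \<in> Delta \<beta>" for d
      using that nth by (auto simp: Delta_def digit_tuples_def intro!: f_base_mono)
  qed
  moreover have "bound (Suc i) = \<beta> ! i * bound i - real_of_int (top ! i)" if "i < p" for i
    using bound_Suc[of i] base_at_less[OF that] nth[OF that] by simp
  then have "prod_list \<beta> * bound 0 = f_base \<beta> top + bound p"
    unfolding f_base_eq
    by (subst expansion[of p bound "\<lambda>i. real_of_int (top ! i)"]) (auto simp: weight_length)
  ultimately have "Max (Delta \<beta>) = (prod_list \<beta> - 1) * x_base \<beta>"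
    by (simp add: bound_0 bound_length algebra_simps)
  then show ?thesis using prod_list_gt_1 by simp
qed

section \<open>Orbits of the greedy transformation\<close>

definition greedy_digit :: "nat \<Rightarrow> real \<Rightarrow> int" where
  "greedy_digit i x = (if x < 1 then \<lfloor>\<beta> ! i * x\<rfloor> else \<lceil>\<beta> ! i\<rceil> - 1)"

primrec remainder :: "real \<Rightarrow> nat \<Rightarrow> real" where
  "remainder x 0 = x"
| "remainder x (Suc i) = \<beta> ! i * remainder x i - greedy_digit i (remainder x i)"

lemma greedy_digit_range:
  assumes "i < p" "0 \<le> x"
  shows "greedy_digit i x \<in> {0..\<lceil>\<beta> ! i\<rceil> - 1}"
proof -
  have b: "1 < \<beta> ! i" using gt_1 assms by simp
  have "\<lfloor>\<beta> ! i * x\<rfloor> < \<lceil>\<beta> ! i\<rceil>" if "x < 1"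
  proof -
    have "\<beta> ! i * x < \<beta> ! i" using that b by simp
    then show ?thesis by linarith
  qed
  moreover have "0 \<le> \<beta> ! i * x" using b assms by simp
  ultimately show ?thesis using b by (auto simp: greedy_digit_def)
qed

text \<open>Below 1 the result is a fractional part, and \<open>bound (Suc i)\<close> is at least 1.
  From 1 on, \<open>bound_Suc\<close> gives the upper estimate, and
  \<open>\<lceil>\<beta> ! i\<rceil> - 1 < \<beta> ! i\<close> the lower one.\<close>

lemma remainder_step:
  assumes "i < p" "0 \<le> x" "x < bound i"
  shows "0 \<le> \<beta> ! i * x - greedy_digit i x" "\<beta> ! i * x - greedy_digit i x < bound (Suc i)"
proof -
  have b: "1 < \<beta> ! i" using gt_1 assms by simp
  have "0 \<le> \<beta> ! i * x - greedy_digit i x \<and> \<beta> ! i * x - greedy_digit i x < bound (Suc i)"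
  proof (cases "x < 1")
    case True
    then show ?thesis using bound_ge_1[of "Suc i"] by (simp add: greedy_digit_def) linarith
  next
    case False
    have "\<beta> ! i * x < \<beta> ! i * bound i" using b assms by simp
    also have "\<dots> = real_of_int \<lceil>\<beta> ! i\<rceil> - 1 + bound (Suc i)"
      using bound_Suc[of i] base_at_less[of i] assms by simp
    finally have "\<beta> ! i * x - greedy_digit i x < bound (Suc i)"
      using False by (simp add: greedy_digit_def)
    moreover have "\<beta> ! i \<le> \<beta> ! i * x" using False b by simp
    ultimately show ?thesis using False by (simp add: greedy_digit_def) linarith
  qed
  then show "0 \<le> \<beta> ! i * x - greedy_digit i x" "\<beta> ! i * x - greedy_digit i x < bound (Suc i)"
    by auto
qed

lemma remainder_range:
  assumes "0 \<le> x" "x < x_base \<beta>" "i \<le> p"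
  shows "0 \<le> remainder x i \<and> remainder x i < bound i"
  using assms
proof (induction i)
  case (Suc i)
  then show ?case using remainder_step[of i "remainder x i"] by simp
qed (simp add: bound_0)

lemma greedy_eq:
  assumes "i < p" "0 \<le> x" "x < bound i"
  shows "greedy \<beta> (i, x) = (Suc i mod p, \<beta> ! i * x - greedy_digit i x)"
  using assms by (simp add: greedy_def greedy_dom_def bound_def greedy_digit_def)

lemma greedy_funpow:
  assumes "0 \<le> x" "x < x_base \<beta>" "i \<le> p"
  shows "(greedy \<beta> ^^ i) (0, x) = (i mod p, remainder x i)"
  using assms
proof (induction i)
  case (Suc i)
  then show ?case using remainder_range[of x i] by (simp add: greedy_eq)
qed simp

text \<open>Only the floor branch can produce a non-maximal digit, and there the remainder is a
  fractional part.\<close>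

lemma remainder_less_1:
  assumes "greedy_digit i (remainder x i) < \<lceil>\<beta> ! i\<rceil> - 1"
  shows "remainder x (Suc i) < 1"
  using assms by (auto simp: greedy_digit_def split: if_splits) linarith

section \<open>Lexicographic maximality of the greedy digit tuple\<close>

definition greedy_tuple :: "real \<Rightarrow> int list" where
  "greedy_tuple x = map (\<lambda>i. greedy_digit i (remainder x i)) [0..<p]"

lemma greedy_tuple_nth: "i < p \<Longrightarrow> greedy_tuple x ! i = greedy_digit i (remainder x i)"
  by (simp add: greedy_tuple_def)

lemma greedy_tuple_in_digit_tuples:
  assumes "0 \<le> x" "x < x_base \<beta>"
  shows "greedy_tuple x \<in> digit_tuples \<beta>"
  unfolding digit_tuples_def
  using remainder_range[OF assms] greedy_digit_range greedy_tuple_nth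
  by (auto simp: greedy_tuple_def simp del: atLeastAtMost_iff)

lemma remainder_expansion:
  assumes "n \<le> p"
  shows "prod_list \<beta> * x = (\<Sum>i<n. weight (Suc i) * greedy_tuple x ! i) + weight n * remainder x n"
  using expansion[of n "remainder x" "\<lambda>i. real_of_int (greedy_tuple x ! i)"] assms
  by (simp add: greedy_tuple_nth)

lemma remainder_length: "remainder x p = prod_list \<beta> * x - f_base \<beta> (greedy_tuple x)"
  using remainder_expansion[of p x] by (simp add: f_base_eq weight_length)

lemma greedy_tuple_lex_maximal:
  assumes c: "c \<in> digit_tuples \<beta>" and i: "i < p"
    and eq: "\<And>j. j < i \<Longrightarrow> c ! j = greedy_tuple x ! j" and gt: "greedy_tuple x ! i < c ! i"
  shows "prod_list \<beta> * x < f_base \<beta> c"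
proof -
  have "greedy_digit i (remainder x i) < \<lceil>\<beta> ! i\<rceil> - 1"
    using c i gt by (fastforce simp: digit_tuples_def greedy_tuple_nth)
  then have "remainder x (Suc i) < 1" by (rule remainder_less_1)
  then have "weight (Suc i) * remainder x (Suc i) < weight (Suc i)"
    using weight_pos[of "Suc i"] by simp
  moreover have "prod_list \<beta> * x =
      (\<Sum>j<Suc i. weight (Suc j) * greedy_tuple x ! j) + weight (Suc i) * remainder x (Suc i)"
    using i by (intro remainder_expansion) simp
  \<comment> \<open>The tail after digit \<open>i\<close> is worth less than one unit of that digit,
    so raising the digit by one already overshoots; the later digits of \<open>c\<close> only add
    nonnegative terms.\<close>
  ultimately have "prod_list \<beta> * x
      < (\<Sum>j<i. weight (Suc j) * greedy_tuple x ! j) + weight (Suc i) * (greedy_tuple x ! i + 1)"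
    by (simp add: algebra_simps)
  also have "\<dots> \<le> (\<Sum>j<i. weight (Suc j) * c ! j) + weight (Suc i) * c ! i"
    using eq gt weight_pos[of "Suc i"] by (intro add_mono mult_left_mono) auto
  also have "\<dots> = (\<Sum>j<Suc i. weight (Suc j) * c ! j)" by simp
  also have "\<dots> \<le> f_base \<beta> c"
    unfolding f_base_eq using i c weight_pos
    by (intro sum_mono2) (auto simp: digit_tuples_def less_imp_le)
  finally show ?thesis .
qed

lemma greedy_tuple_maximal:
  assumes mono: "f_nondecreasing \<beta>" and x: "0 \<le> x" "x < x_base \<beta>"
    and c: "c \<in> digit_tuples \<beta>" and le: "f_base \<beta> c \<le> prod_list \<beta> * x"
  shows "f_base \<beta> c \<le> f_base \<beta> (greedy_tuple x)"
proof (cases "c = greedy_tuple x")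
  case False
  let ?g = "greedy_tuple x"
  have g: "?g \<in> digit_tuples \<beta>" using x by (rule greedy_tuple_in_digit_tuples)
  have len: "length c = p" "length ?g = p" using c g by (auto simp: digit_tuples_def)
  define i where "i = (LEAST i. i < p \<and> c ! i \<noteq> ?g ! i)"
  have "\<exists>i. i < p \<and> c ! i \<noteq> ?g ! i" using False len nth_equalityI by metis
  then have i: "i < p" "c ! i \<noteq> ?g ! i" unfolding i_def by (rule LeastI2_ex, simp)+
  have eq: "c ! j = ?g ! j" if "j < i" for j
    using not_less_Least[of j "\<lambda>i. i < p \<and> c ! i \<noteq> ?g ! i"] that i unfolding i_def by auto
  \<comment> \<open>A larger digit at the first difference would push
    \<open>f_base \<beta> c\<close> above \<open>prod_list \<beta> * x\<close>.\<close>
  have "\<not> ?g ! i < c ! i"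
    using greedy_tuple_lex_maximal[OF c i(1) eq] le by fastforce
  then have "c ! i < ?g ! i" using i by simp
  then have "lex_less c ?g" using len i eq by (intro lex_lessI[of _ _ i]) auto
  then show ?thesis
    using mono c g unfolding f_nondecreasing_def by (rule monotone_onD[rotated 3])
qed simp

end

theorem theorem45:
  fixes p :: nat and \<beta> :: "real list"
  assumes "p \<ge> 1"
    and "length \<beta> = p"
    and "\<forall>i<p. \<beta> ! i > 1"
    and "f_nondecreasing \<beta>"
  shows "greedy_digits (prod_list \<beta>) (Delta \<beta>)
    = restrict (snd \<circ> (greedy \<beta> ^^ p) \<circ> delta0) {0..<x_base \<beta>}"
proof -
  interpret bases \<beta>
    using assms by unfold_locales auto
  \<comment> \<open>The point 0 lies in the domain since \<open>x_base \<beta>\<close> is at least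
    1, so its greedy tuple is a witness.\<close>
  have ne: "Delta \<beta> \<noteq> {}"
    using greedy_tuple_in_digit_tuples[of 0] bound_ge_1[of 0] by (auto simp: Delta_def bound_0)
  \<comment> \<open>Both sides are restricted to the same interval, so they are both
    \<open>undefined\<close> outside it.\<close>
  have dom: "digit (Delta \<beta>) (card (Delta \<beta>) - 1) / (prod_list \<beta> - 1) = x_base \<beta>"
    using digit_last_eq_Max[OF finite_Delta ne] Max_Delta by simp
  show ?thesis
  proof
    fix x
    show "greedy_digits (prod_list \<beta>) (Delta \<beta>) x
        = restrict (snd \<circ> (greedy \<beta> ^^ p) \<circ> delta0) {0..<x_base \<beta>} x"
    proof (cases "x \<in> {0..<x_base \<beta>}")
      case True
      then have x: "0 \<le> x" "x < x_base \<beta>" by auto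
      have "greedy_digits (prod_list \<beta>) (Delta \<beta>) x = prod_list \<beta> * x - f_base \<beta> (greedy_tuple x)"
      proof (rule greedy_digits_eqI[OF finite_Delta])
        show "f_base \<beta> (greedy_tuple x) \<in> Delta \<beta>"
          using greedy_tuple_in_digit_tuples[OF x] by (simp add: Delta_def)
        show "f_base \<beta> (greedy_tuple x) \<le> prod_list \<beta> * x"
          using remainder_range[OF x, of "length \<beta>"] remainder_length[of x] by simp
        show "d \<le> f_base \<beta> (greedy_tuple x)" if "d \<in> Delta \<beta>" "d \<le> prod_list \<beta> * x" for d
          using that greedy_tuple_maximal[OF assms(4) x] by (auto simp: Delta_def)
      qed (use prod_list_gt_1 x Max_Delta in auto)
      also have "\<dots> = snd ((greedy \<beta> ^^ p) (0, x))"
        using greedy_funpow[OF x, of "length \<beta>"] remainder_length[of x] assms(2) by simp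
      finally show ?thesis using True by (simp add: delta0_def)
    next
      case False
      then show ?thesis unfolding greedy_digits_def Let_def dom by (simp only: restrict_apply if_False)
    qed
  qed
qed

end
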